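(* Each of the two Celmins–Swart snarks $S_1$, $S_2$ (given by explicit edge lists in the context) has a planarizing perfect pseudo-matching. Explicitly, the perfect pseudo-matchings $M_1$ of $S_1$ and $M_2$ of $S_2$ given in the context are planarizing.
   Context: A perfect pseudo-matching $M$ in a graph $G$ is a collection of vertex-disjoint subgraphs of $G$, each isomorphic to $K_2$ or $K_{1,3}$, whose vertex sets together cover $V(G)$; $E(M)$ is the set of edges of its members. $G/M$ is the (multi)graph obtained by contracting each member of $M$ to a single vertex. $M$ is planarizing if $G/M$ is planar. Both graphs are cubic with vertex set $\{1,\dots,26\}$; the edge $\{i,j\}$ is written $i$-$j$. $S_1$: the edges of $M_1$ are $1$-$2$, $5$-$6$, $7$-$8$, $21$-$23$, $22$-$24$, $19$-$25$, $20$-$26$, and the three claws with center $14$ and leaves $9,10,18$; center $16$ and leaves $11,12,17$; center $13$ and leaves $3,4,15$. The remaining edges of $S_1$ are $1$-$4$, $2$-$3$, $5$-$10$, $6$-$9$, $8$-$11$, $7$-$12$, $3$-$10$, $4$-$11$, $5$-$21$, $9$-$23$, $8$-$22$, $12$-$24$, $1$-$6$, $2$-$7$, $23$-$25$, $25$-$26$, $24$-$26$, $18$-$21$, $18$-$19$, $17$-$20$, $17$-$22$, $15$-$20$, $15$-$19$. $S_2$: the edges of $M_2$ are $1$-$8$, $2$-$5$, $13$-$14$, $21$-$22$, $23$-$24$, and the four claws with center $4$ and leaves $3,6,7$; center $10$ and leaves $9,11,12$; center $18$ and leaves $16,25,26$; center $17$ and leaves $15,19,20$. The remaining edges of $S_2$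 are $1$-$3$, $2$-$3$, $6$-$8$, $1$-$20$, $8$-$21$, $5$-$7$, $2$-$26$, $5$-$23$, $22$-$24$, $19$-$21$, $19$-$25$, $23$-$25$, $20$-$22$, $24$-$26$, $6$-$9$, $7$-$11$, $9$-$13$, $11$-$14$, $12$-$15$, $12$-$16$, $14$-$15$, $13$-$16$. *)

theory Defs
  imports "HOL-Analysis.Analysis"
begin

section \<open>Simple graphs and perfect pseudo-matchings\<close>

record 'a sgraph =
  verts :: "'a set"
  edges :: "'a set set"

definition simple_graph :: "'a sgraph \<Rightarrow> bool" where
  "simple_graph G \<longleftrightarrow>
     finite (verts G) \<and> (\<forall>e \<in> edges G. e \<subseteq> verts G \<and> card e = 2)"

definition cubic :: "'a sgraph \<Rightarrow> bool" where
  "cubic G \<longleftrightarrow> simple_graph G \<and> (\<forall>v \<in> verts G. card {e \<in> edges G. v \<in> e} = 3)"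

definition is_subgraph :: "'a sgraph \<Rightarrow> 'a sgraph \<Rightarrow> bool" where
  "is_subgraph H G \<longleftrightarrow> simple_graph H \<and> verts H \<subseteq> verts G \<and> edges H \<subseteq> edges G"

definition isomorphic :: "'a sgraph \<Rightarrow> 'b sgraph \<Rightarrow> bool" where
  "isomorphic G H \<longleftrightarrow>
     (\<exists>f. bij_betw f (verts G) (verts H) \<and> (\<lambda>e. f ` e) ` edges G = edges H)"

definition K2 :: "nat sgraph" where
  "K2 = \<lparr>verts = {0, 1}, edges = {{0, 1}}\<rparr>"

definition K13 :: "nat sgraph" where
  "K13 = \<lparr>verts = {0, 1, 2, 3}, edges = {{0, 1}, {0, 2}, {0, 3}}\<rparr>"

definition perfect_pseudo_matching :: "'a sgraph \<Rightarrow> 'a sgraph set \<Rightarrow> bool" where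
  "perfect_pseudo_matching G M \<longleftrightarrow>
     (\<forall>H \<in> M. is_subgraph H G \<and> (isomorphic H K2 \<or> isomorphic H K13)) \<and>
     (\<forall>H \<in> M. \<forall>H' \<in> M. H \<noteq> H' \<longrightarrow> verts H \<inter> verts H' = {}) \<and>
     (\<Union>H \<in> M. verts H) = verts G"

definition matching_edges :: "'a sgraph set \<Rightarrow> 'a set set" where
  "matching_edges M = (\<Union>H \<in> M. edges H)"


section \<open>Multigraphs, contraction and planarity\<close>

text \<open>The set \<open>ends H e\<close> of end vertices of an edge \<open>e\<close> has two elements, or one if
  \<open>e\<close> is a loop; different edges may have the same ends.\<close>

record ('v, 'e) multigraph =
  mverts :: "'v set"
  medges :: "'e set"
  ends :: "'e \<Rightarrow> 'v set"

text \<open>Only meant for a vertex-disjoint collection \<open>M\<close> that covers all vertices of \<open>G\<close>.  The vertex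
  to which a member of \<open>M\<close> is contracted is represented by that member.  Parallel edges are kept,
  and an edge outside \<open>M\<close> with both end vertices in one member becomes a loop.\<close>

definition contraction :: "'a sgraph \<Rightarrow> 'a sgraph set \<Rightarrow> ('a sgraph, 'a set) multigraph" where
  "contraction G M =
     \<lparr>mverts = M,
      medges = edges G - matching_edges M,
      ends = (\<lambda>e. {H \<in> M. verts H \<inter> e \<noteq> {}})\<rparr>"

text \<open>A drawing of a finite multigraph in the plane without crossings.  By injectivity of \<open>p\<close>, the
  curve of an edge with two ends is an arc and that of a loop is a simple closed curve.\<close>

definition plane_embedding ::
  "('v, 'e) multigraph \<Rightarrow> ('v \<Rightarrow> complex) \<Rightarrow> ('e \<Rightarrow> real \<Rightarrow> complex) \<Rightarrow> bool" where
  "plane_embedding H p c \<longleftrightarrow>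
     inj_on p (mverts H) \<and>
     (\<forall>e \<in> medges H.
        simple_path (c e) \<and>
        {pathstart (c e), pathfinish (c e)} = p ` ends H e \<and>
        path_image (c e) \<inter> p ` mverts H = p ` ends H e) \<and>
     (\<forall>e \<in> medges H. \<forall>f \<in> medges H. e \<noteq> f \<longrightarrow>
        path_image (c e) \<inter> path_image (c f) = p ` (ends H e \<inter> ends H f))"

definition planar :: "('v, 'e) multigraph \<Rightarrow> bool" where
  "planar H \<longleftrightarrow> finite (mverts H) \<and> finite (medges H) \<and> (\<exists>p c. plane_embedding H p c)"

definition planarizing :: "'a sgraph \<Rightarrow> 'a sgraph set \<Rightarrow> bool" where
  "planarizing G M \<longleftrightarrow> planar (contraction G M)"


section \<open>The two Celmins--Swart snarks\<close>

definition edge_set :: "('a \<times> 'a) set \<Rightarrow> 'a set set" where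
  "edge_set P = (\<lambda>(u, v). {u, v}) ` P"

definition single_edge :: "'a \<times> 'a \<Rightarrow> 'a sgraph" where
  "single_edge = (\<lambda>(u, v). \<lparr>verts = {u, v}, edges = {{u, v}}\<rparr>)"

definition claw :: "'a \<Rightarrow> 'a set \<Rightarrow> 'a sgraph" where
  "claw z L = \<lparr>verts = insert z L, edges = (\<lambda>l. {z, l}) ` L\<rparr>"

definition M1 :: "nat sgraph set" where
  "M1 = single_edge ` {(1,2), (5,6), (7,8), (21,23), (22,24), (19,25), (20,26)} \<union>
        {claw 14 {9,10,18}, claw 16 {11,12,17}, claw 13 {3,4,15}}"

definition S1 :: "nat sgraph" where
  "S1 = \<lparr>verts = {1..26},
         edges = matching_edges M1 \<union> edge_set
           {(1,4), (2,3), (5,10), (6,9), (8,11), (7,12), (3,10), (4,11), (5,21), (9,23), (8,22),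
            (12,24), (1,6), (2,7), (23,25), (25,26), (24,26), (18,21), (18,19), (17,20), (17,22),
            (15,20), (15,19)}\<rparr>"

definition M2 :: "nat sgraph set" where
  "M2 = single_edge ` {(1,8), (2,5), (13,14), (21,22), (23,24)} \<union>
        {claw 4 {3,6,7}, claw 10 {9,11,12}, claw 18 {16,25,26}, claw 17 {15,19,20}}"

definition S2 :: "nat sgraph" where
  "S2 = \<lparr>verts = {1..26},
         edges = matching_edges M2 \<union> edge_set
           {(1,3), (2,3), (6,8), (1,20), (8,21), (5,7), (2,26), (5,23), (22,24), (19,21), (19,25),
            (23,25), (20,22), (24,26), (6,9), (7,11), (9,13), (11,14), (12,15), (12,16), (14,15),
            (13,16)}\<rparr>"

lemma edges_S1:
  "edges S1 = edge_set
     {(1,2), (5,6), (7,8), (21,23), (22,24), (19,25), (20,26),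
      (14,9), (14,10), (14,18), (16,11), (16,12), (16,17), (13,3), (13,4), (13,15),
      (1,4), (2,3), (5,10), (6,9), (8,11), (7,12), (3,10), (4,11), (5,21), (9,23), (8,22),
      (12,24), (1,6), (2,7), (23,25), (25,26), (24,26), (18,21), (18,19), (17,20), (17,22),
      (15,20), (15,19)}"
  by (simp add: S1_def M1_def matching_edges_def single_edge_def claw_def edge_set_def)
     (rule set_eqI, simp only: insert_iff empty_iff disj_ac)

lemma edges_S2:
  "edges S2 = edge_set
     {(1,8), (2,5), (13,14), (21,22), (23,24),
      (4,3), (4,6), (4,7), (10,9), (10,11), (10,12), (18,16), (18,25), (18,26),
      (17,15), (17,19), (17,20),
      (1,3), (2,3), (6,8), (1,20), (8,21), (5,7), (2,26), (5,23), (22,24), (19,21), (19,25),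
      (23,25), (20,22), (24,26), (6,9), (7,11), (9,13), (11,14), (12,15), (12,16), (14,15),
      (13,16)}"
  by (simp add: S2_def M2_def matching_edges_def single_edge_def claw_def edge_set_def)
     (rule set_eqI, simp only: insert_iff empty_iff disj_ac)

lemma upto_26:
  "{1..26::nat} = {1,2,3,4,5,6,7,8,9,10,11,12,13,14,15,16,17,18,19,20,21,22,23,24,25,26}"
  by (simp add: set_eq_iff) presburger

lemma incident_insert:
  "{e \<in> edge_set (insert (a, b) P). v \<in> e} =
     (if v = a \<or> v = b then insert {a, b} {e \<in> edge_set P. v \<in> e} else {e \<in> edge_set P. v \<in> e})"
  by (auto simp: edge_set_def)

lemma incident_empty: "{e \<in> edge_set {}. v \<in> e} = {}"
  by (simp add: edge_set_def)

lemma cubic_S1: "cubic S1"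
proof -
  have v: "verts S1 = {1..26}"
    by (simp add: S1_def)
  have "simple_graph S1"
    unfolding simple_graph_def v edges_S1 by (simp add: edge_set_def)
  moreover have "\<forall>v \<in> verts S1. card {e \<in> edges S1. v \<in> e} = 3"
    unfolding v upto_26 edges_S1
    by (intro ballI, elim insertE emptyE)
      (simp_all add: incident_insert incident_empty doubleton_eq_iff)
  ultimately show ?thesis
    by (simp add: cubic_def)
qed

lemma cubic_S2: "cubic S2"
proof -
  have v: "verts S2 = {1..26}"
    by (simp add: S2_def)
  have "simple_graph S2"
    unfolding simple_graph_def v edges_S2 by (simp add: edge_set_def)
  moreover have "\<forall>v \<in> verts S2. card {e \<in> edges S2. v \<in> e} = 3"
    unfolding v upto_26 edges_S2
    by (intro ballI, elim insertE emptyE)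
      (simp_all add: incident_insert incident_empty doubleton_eq_iff)
  ultimately show ?thesis
    by (simp add: cubic_def)
qed

end

theory Submission
  imports Defs
begin

text \<open>Each contracted graph is drawn with its vertices at integer points and every edge as a polygonal
  arc with one bend, which lets parallel edges run on different sides.  That two segments are disjoint
  follows when both ends of one lie strictly on the same side of the line through the other, so that
  the absence of crossings reduces to finitely many signs of integer determinants.\<close>

section \<open>Polygonal drawings with integer coordinates\<close>

text \<open>Twice the signed area of the triangle \<open>a b c\<close>: its sign tells on which side
  of the directed line from \<open>a\<close> to \<open>b\<close> the point \<open>c\<close> lies,
  and it is positive on the left.\<close>

definition cross :: "complex \<Rightarrow> complex \<Rightarrow> complex \<Rightarrow> real" where
  "cross a b c = Im (cnj (b - a) * (c - a))"

lemma cross_affine: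
  "cross a b ((1 - t) *\<^sub>R c + t *\<^sub>R d) = (1 - t) * cross a b c + t * cross a b d"
  by (simp add: cross_def algebra_simps)

lemma cross_degenerate [simp]: "cross a b a = 0" "cross a b b = 0" "cross a a c = 0"
  by (simp_all add: cross_def algebra_simps)

lemma cross_on_segment: "x \<in> closed_segment a b \<Longrightarrow> cross a b x = 0"
  by (auto simp: in_segment cross_affine)

lemma cross_pos_on_segment:
  assumes "x \<in> closed_segment c d" "cross a b c > 0" "cross a b d > 0"
  shows "cross a b x > 0"
proof -
  obtain t where t: "0 \<le> t" "t \<le> 1" and x: "x = (1 - t) *\<^sub>R c + t *\<^sub>R d"
    using assms(1) by (auto simp: in_segment)
  show ?thesis
  \<comment> \<open>At \<open>t = 0\<close> the strict sign comes from \<open>c\<close>, otherwise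
    from the summand of \<open>d\<close>.\<close>
  proof (cases "t = 0")
    case False
    then have "t * cross a b d > 0"
      using t assms(3) by simp
    moreover have "(1 - t) * cross a b c \<ge> 0"
      using t assms(2) by simp
    ultimately show ?thesis
      by (simp add: x cross_affine)
  qed (use assms(2) x in simp)
qed

lemma cross_swap: "cross b a c = - cross a b c"
  by (simp add: cross_def algebra_simps)

text \<open>\<open>cross a b\<close> vanishes on the first segment, while convexity of open
  half-planes keeps its strict sign along the second.\<close>

lemma segments_disjoint:
  assumes "cross a b c * cross a b d > 0"
  shows "closed_segment a b \<inter> closed_segment c d = {}"
proof -
  have False if x: "x \<in> closed_segment a b" "x \<in> closed_segment c d" for x
  proof (cases "cross a b c > 0")
    case True
    then have "cross a b d > 0"
      using assms by (simp add: zero_less_mult_iff)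
    with True show False
      using cross_pos_on_segment[OF x(2)] cross_on_segment[OF x(1)] by fastforce
  next
    case False
    \<comment> \<open>Reversing the direction of the line exchanges its sides and leads back to the
      positive case.\<close>
    then have "cross b a c > 0" "cross b a d > 0"
      using assms by (auto simp: zero_less_mult_iff cross_swap[of b a])
    then show False
      using cross_pos_on_segment[OF x(2)] cross_on_segment[OF x(1)] cross_swap[of b a x]
      by fastforce
  qed
  then show ?thesis
    by blast
qed

text \<open>At parameter \<open>t\<close> of the segment from \<open>a\<close> to \<open>c\<close>
  the signed area is \<open>t * cross a b c\<close>, which vanishes only at
  \<open>t = 0\<close>.\<close>

lemma segments_meet_at_common_end:
  assumes "cross a b c \<noteq> 0"
  shows "closed_segment a b \<inter> closed_segment a c = {a}"
proof -
  have "x = a" if x: "x \<in> closed_segment a b" "x \<in> closed_segment a c" for x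
  proof -
    obtain t where t: "x = (1 - t) *\<^sub>R a + t *\<^sub>R c"
      using x(2) by (auto simp: in_segment)
    then have "t * cross a b c = 0"
      using cross_on_segment[OF x(1)] by (simp add: cross_affine)
    then show "x = a"
      using t assms by simp
  qed
  then show ?thesis
    by auto
qed

section \<open>Integer points and arcs with one bend\<close>

type_synonym point = "int \<times> int"

fun to_complex :: "point \<Rightarrow> complex" where
  "to_complex (x, y) = Complex (of_int x) (of_int y)"

text \<open>The integer counterpart of \<open>cross\<close>, which makes the sign conditions
  decidable by evaluation.\<close>

fun turn :: "point \<Rightarrow> point \<Rightarrow> point \<Rightarrow> int" where
  "turn (x, y) (x', y') (x'', y'') = (x' - x) * (y'' - y) - (y' - y) * (x'' - x)"

lemma cross_to_complex: "cross (to_complex a) (to_complex b) (to_complex c) = of_int (turn a b c)"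
  by (cases a; cases b; cases c) (simp add: cross_def algebra_simps)

lemma inj_to_complex: "inj to_complex"
  by (rule injI) (auto elim!: to_complex.elims)

text \<open>Here \<open>a\<close> and \<open>b\<close> are meant as vertices and \<open>m\<close>
  and \<open>n\<close> as bends, so \<open>a = b\<close> is the only contact allowed. The test is
  sufficient for this.\<close>

definition segments_compatible :: "point \<Rightarrow> point \<Rightarrow> point \<Rightarrow> point \<Rightarrow> bool" where
  "segments_compatible a m b n \<longleftrightarrow>
     (if a = b then turn a m n \<noteq> 0
      else turn a m b * turn a m n > 0 \<or> turn b n a * turn b n m > 0)"

abbreviation segment :: "point \<Rightarrow> point \<Rightarrow> complex set" where
  "segment a m \<equiv> closed_segment (to_complex a) (to_complex m)"

text \<open>The bound \<open>{a} \<inter> {b}\<close> covers both cases at once, and the four bounds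
  for a pair of arcs unite to their common ends.\<close>

lemma segments_compatible_Int:
  assumes "segments_compatible a m b n"
  shows "segment a m \<inter> segment b n \<subseteq> to_complex ` ({a} \<inter> {b})"
proof (cases "a = b")
  case True
  then show ?thesis
    using assms segments_meet_at_common_end[of "to_complex a" "to_complex m" "to_complex n"]
    by (simp add: segments_compatible_def cross_to_complex)
next
  case False
  then have "turn a m b * turn a m n > 0 \<or> turn b n a * turn b n m > 0"
    using assms by (simp add: segments_compatible_def)
  then have "segment a m \<inter> segment b n = {}"
  proof
    assume "turn a m b * turn a m n > 0"
    then show ?thesis
      by (intro segments_disjoint) (simp add: cross_to_complex flip: of_int_mult)
  next
    assume "turn b n a * turn b n m > 0"
    then have "segment b n \<inter> segment a m = {}"
      by (intro segments_disjoint) (simp add: cross_to_complex flip: of_int_mult)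
    then show ?thesis
      by blast
  qed
  then show ?thesis
    by blast
qed

text \<open>A triple \<open>(a, m, b)\<close> stands for the polygonal arc from \<open>a\<close> to \<open>b\<close> with one bend, at \<open>m\<close>.\<close>

type_synonym bent_arc = "point \<times> point \<times> point"

fun bent_path :: "bent_arc \<Rightarrow> real \<Rightarrow> complex" where
  "bent_path (a, m, b) =
     linepath (to_complex a) (to_complex m) +++ linepath (to_complex m) (to_complex b)"

text \<open>A nonzero turn also forces \<open>a \<noteq> b\<close>, so loops cannot be drawn this
  way; neither of the two contractions has one.\<close>

fun bent :: "bent_arc \<Rightarrow> bool" where
  "bent (a, m, b) \<longleftrightarrow> turn m a b \<noteq> 0"

fun arcs_compatible :: "bent_arc \<Rightarrow> bent_arc \<Rightarrow> bool" where
  "arcs_compatible (a, m, b) (c, n, d) \<longleftrightarrow>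
     segments_compatible a m c n \<and> segments_compatible a m d n \<and>
     segments_compatible b m c n \<and> segments_compatible b m d n"

text \<open>Each pair of arcs is tested once, in list order; this suffices because intersection is
  symmetric.\<close>

definition uncrossed :: "bent_arc list \<Rightarrow> bool" where
  "uncrossed xs \<longleftrightarrow> list_all bent xs \<and> sorted_wrt arcs_compatible xs"

lemma path_image_bent_path: "path_image (bent_path (a, m, b)) = segment a m \<union> segment b m"
  by (simp add: path_image_join closed_segment_commute)

lemma bent_path_ends [simp]:
  "pathstart (bent_path (a, m, b)) = to_complex a"
  "pathfinish (bent_path (a, m, b)) = to_complex b"
  by simp_all

text \<open>The two segments leave the bend in non-collinear directions, so they meet only there and
  their join is an arc.\<close>

lemma simple_path_bent_path:
  assumes "bent (a, m, b)"
  shows "simple_path (bent_path (a, m, b))"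
proof -
  have turn: "turn m a b \<noteq> 0"
    using assms by simp
  then have "to_complex a \<noteq> to_complex m" "to_complex m \<noteq> to_complex b"
    using inj_eq[OF inj_to_complex] cross_to_complex[of m a b] by auto
  moreover have "segment a m \<inter> segment m b \<subseteq> {to_complex m}"
    using turn segments_meet_at_common_end[of "to_complex m" "to_complex a" "to_complex b"]
    by (simp add: cross_to_complex closed_segment_commute)
  ultimately have "arc (bent_path (a, m, b))"
    by (auto intro!: arc_join)
  then show ?thesis
    by (rule arc_imp_simple_path)
qed

lemma arcs_compatible_Int:
  assumes "arcs_compatible (a, m, b) (c, n, d)"
  shows "path_image (bent_path (a, m, b)) \<inter> path_image (bent_path (c, n, d)) =
    to_complex ` ({a, b} \<inter> {c, d})"
proof
  show "path_image (bent_path (a, m, b)) \<inter> path_image (bent_path (c, n, d)) \<subseteq>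
      to_complex ` ({a, b} \<inter> {c, d})"
    using assms segments_compatible_Int[of a m c n] segments_compatible_Int[of a m d n]
      segments_compatible_Int[of b m c n] segments_compatible_Int[of b m d n]
    unfolding path_image_bent_path arcs_compatible.simps by blast
  show "to_complex ` ({a, b} \<inter> {c, d}) \<subseteq>
      path_image (bent_path (a, m, b)) \<inter> path_image (bent_path (c, n, d))"
    unfolding path_image_bent_path by auto
qed

lemma sorted_wrt_distinct_members:
  assumes "sorted_wrt P xs" "x \<in> set xs" "y \<in> set xs" "x \<noteq> y"
  shows "P x y \<or> P y x"
  using assms by (induction xs) auto

section \<open>Drawing a contraction\<close>

text \<open>An entry \<open>(i, j, m)\<close> of \<open>D\<close> is the edge \<open>{i, j}\<close> drawn with its bend at \<open>m\<close>; the
  contracted vertex containing \<open>v\<close> is placed at \<open>q v\<close>.  The condition that no contracted vertex is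
  isolated lets the crossing condition on arcs also exclude vertices in the interior of an arc.\<close>

lemma planarizing_if_drawing:
  fixes q :: "'a \<Rightarrow> point" and D :: "('a \<times> 'a \<times> point) list"
  assumes M: "perfect_pseudo_matching G M" and "finite M"
    and q: "\<And>H i v. H \<in> M \<Longrightarrow> i \<in> verts H \<Longrightarrow> v \<in> verts G \<Longrightarrow> q v = q i \<longleftrightarrow> v \<in> verts H"
    and D: "edges G - matching_edges M = (\<lambda>(i, j, m). {i, j}) ` set D"
    and in_G: "\<And>i j m. (i, j, m) \<in> set D \<Longrightarrow> i \<in> verts G \<and> j \<in> verts G"
    and no_isolated: "\<And>H. H \<in> M \<Longrightarrow> \<exists>(i, j, m) \<in> set D. i \<in> verts H \<or> j \<in> verts H"
    and uncrossed: "uncrossed (map (\<lambda>(i, j, m). (q i, m, q j)) D)"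
  shows "planarizing G M"
proof -
  define C where "C = contraction G M"
  have C: "mverts C = M" "medges C = (\<lambda>(i, j, m). {i, j}) ` set D"
    "ends C = (\<lambda>e. {H \<in> M. verts H \<inter> e \<noteq> {}})"
    using D by (simp_all add: C_def contraction_def)
  \<comment> \<open>The choice is immaterial: \<open>q\<close> is constant on each member.\<close>
  define p where "p H = to_complex (q (SOME i. i \<in> verts H))" for H :: "'a sgraph"
  have nonempty: "verts H \<noteq> {}" if "H \<in> M" for H
    using no_isolated[OF that] by auto
  have p: "p H = to_complex (q i)" if "H \<in> M" "i \<in> verts H" for H i
  proof -
    have some: "(SOME i. i \<in> verts H) \<in> verts H"
      using that(2) by (rule someI)
    moreover from this have "(SOME i. i \<in> verts H) \<in> verts G"
      using M that(1) unfolding perfect_pseudo_matching_def by blast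
    ultimately have "q (SOME i. i \<in> verts H) = q i"
      using q[OF that] by blast
    then show ?thesis
      unfolding p_def by (rule arg_cong)
  qed
  have cover: "\<exists>H \<in> M. i \<in> verts H" if "i \<in> verts G" for i
    using M that unfolding perfect_pseudo_matching_def by blast
  have in_verts: "i \<in> verts G" if "H \<in> M" "i \<in> verts H" for H i
    using M that unfolding perfect_pseudo_matching_def by blast
  have member_unique: "H = H'" if "H \<in> M" "H' \<in> M" "i \<in> verts H" "i \<in> verts H'" for H H' i
    using M that unfolding perfect_pseudo_matching_def by blast
  have inj_p: "inj_on p M"
  proof (rule inj_onI)
    fix H H' assume H: "H \<in> M" "H' \<in> M" and "p H = p H'"
    obtain i j where ij: "i \<in> verts H" "j \<in> verts H'"
      using nonempty H by blast
    then have "q j = q i"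
      using \<open>p H = p H'\<close> p H inj_eq[OF inj_to_complex] by metis
    then have "j \<in> verts H"
      using q H ij in_verts by blast
    then show "H = H'"
      using H ij member_unique by blast
  qed
  \<comment> \<open>Members are disjoint and cover the graph, so each of \<open>i\<close> and
    \<open>j\<close> lies in exactly one of them.\<close>
  have p_ends: "p ` ends C {i, j} = to_complex ` {q i, q j}"
    if ij: "i \<in> verts G" "j \<in> verts G" for i j
  proof -
    obtain H H' where H: "H \<in> M" "i \<in> verts H" "H' \<in> M" "j \<in> verts H'"
      using ij cover by blast
    then have "ends C {i, j} = {H, H'}"
      unfolding C by (auto dest: member_unique)
    then show ?thesis
      using H p by simp
  qed
  \<comment> \<open>A drawing assigns curves to edges, whereas \<open>D\<close> lists entries; one
    entry is chosen for each edge.\<close>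
  define entry where "entry e = (SOME x. x \<in> set D \<and> (\<lambda>(i, j, m). {i, j}) x = e)" for e
  define c where "c e = (\<lambda>(i, j, m). bent_path (q i, m, q j)) (entry e)" for e
  have entry: "\<exists>i j m. entry e = (i, j, m) \<and> (i, j, m) \<in> set D \<and> e = {i, j}"
    if e: "e \<in> medges C" for e
  proof -
    have "\<exists>x. x \<in> set D \<and> (\<lambda>(i, j, m). {i, j}) x = e"
      using e unfolding C by blast
    then have "entry e \<in> set D \<and> (\<lambda>(i, j, m). {i, j}) (entry e) = e"
      unfolding entry_def by (rule someI_ex)
    then show ?thesis
      by (cases "entry e") auto
  qed
  have meet: "path_image (c e) \<inter> path_image (c f) = p ` (ends C e \<inter> ends C f)"
    if ef: "e \<in> medges C" "f \<in> medges C" "e \<noteq> f" for e f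
  proof -
    obtain i j m where e: "entry e = (i, j, m)" "(i, j, m) \<in> set D" "e = {i, j}"
      using entry ef(1) by blast
    obtain i' j' m' where f: "entry f = (i', j', m')" "(i', j', m') \<in> set D" "f = {i', j'}"
      using entry ef(2) by blast
    \<comment> \<open>An entry determines its edge, so distinct edges have distinct entries, which
      were tested against each other in one of the two orders.\<close>
    have "(i, j, m) \<noteq> (i', j', m')"
      using ef(3) e(3) f(3) by auto
    then have "arcs_compatible (q i, m, q j) (q i', m', q j') \<or>
        arcs_compatible (q i', m', q j') (q i, m, q j)"
      using sorted_wrt_distinct_members[OF _ e(2) f(2)] uncrossed
      unfolding uncrossed_def sorted_wrt_map by fastforce
    then have "path_image (c e) \<inter> path_image (c f) = to_complex ` ({q i, q j} \<inter> {q i', q j'})"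
      using arcs_compatible_Int unfolding c_def e(1) f(1) prod.case by (metis Int_commute)
    also have "\<dots> = to_complex ` {q i, q j} \<inter> to_complex ` {q i', q j'}"
      by (rule image_Int[OF inj_to_complex])
    also have "\<dots> = p ` ends C e \<inter> p ` ends C f"
      using p_ends in_G e f by metis
    also have "\<dots> = p ` (ends C e \<inter> ends C f)"
      by (rule inj_on_image_Int[OF inj_p, symmetric]) (auto simp: C)
    finally show ?thesis .
  qed
  have "plane_embedding C p c"
    unfolding plane_embedding_def
  proof (intro conjI ballI impI)
    show "inj_on p (mverts C)"
      using inj_p C by simp
    show "path_image (c e) \<inter> path_image (c f) = p ` (ends C e \<inter> ends C f)"
      if "e \<in> medges C" "f \<in> medges C" "e \<noteq> f" for e f
      using meet that .
    fix e assume e: "e \<in> medges C"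
    then obtain i j m where ijm: "entry e = (i, j, m)" "(i, j, m) \<in> set D" "e = {i, j}"
      using entry by blast
    have c: "c e = bent_path (q i, m, q j)"
      unfolding c_def ijm(1) by simp
    have "bent (q i, m, q j)"
      using uncrossed ijm(2) unfolding uncrossed_def list.pred_map list_all_iff by fastforce
    then show "simple_path (c e)"
      unfolding c by (rule simple_path_bent_path)
    have ends: "p ` ends C e = to_complex ` {q i, q j}"
      using p_ends in_G ijm by metis
    then show "{pathstart (c e), pathfinish (c e)} = p ` ends C e"
      unfolding c bent_path_ends by simp
    show "path_image (c e) \<inter> p ` mverts C = p ` ends C e"
    proof
      show "p ` ends C e \<subseteq> path_image (c e) \<inter> p ` mverts C"
        using ends by (auto simp: c path_image_bent_path C simp del: bent_path.simps)
      show "path_image (c e) \<inter> p ` mverts C \<subseteq> p ` ends C e"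
      proof
        \<comment> \<open>The vertex at \<open>x\<close> is an end of some edge \<open>f\<close>.
          Either \<open>f = e\<close>, or \<open>x\<close> lies on both arcs and \<open>meet\<close>
          makes it the image of a common end.\<close>
        fix x assume x: "x \<in> path_image (c e) \<inter> p ` mverts C"
        then obtain H where H: "H \<in> M" "x = p H"
          using C by auto
        then obtain i' j' m' where f: "(i', j', m') \<in> set D" "i' \<in> verts H \<or> j' \<in> verts H"
          using no_isolated by blast
        define f where "f = {i', j'}"
        have f_edge: "f \<in> medges C" and H_f: "H \<in> ends C f"
          using f H(1) by (force simp: C f_def)+
        show "x \<in> p ` ends C e"
        proof (cases "f = e")
          case False
          obtain k l n where g: "entry f = (k, l, n)" "(k, l, n) \<in> set D" "f = {k, l}"
            using entry f_edge by blast
          have "x \<in> to_complex ` {q k, q l}"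
            using p_ends in_G g H_f H(2) by (metis imageI)
          then have "x \<in> path_image (c f)"
            unfolding c_def g(1) by (auto simp: path_image_bent_path simp del: bent_path.simps)
          then have "x \<in> p ` (ends C e \<inter> ends C f)"
            using meet[OF e f_edge] False x by blast
          then show ?thesis
            by blast
        qed (use H_f H(2) in blast)
      qed
    qed
  qed
  then show ?thesis
    using \<open>finite M\<close> C unfolding planarizing_def planar_def C_def[symmetric] by auto
qed


section \<open>The two snarks\<close>

text \<open>Reduces the subgraph condition to membership facts that the simplifier decides on
  explicit sets.\<close>

lemma is_subgraph_single_edge:
  "is_subgraph (single_edge (u, v)) G \<longleftrightarrow> u \<noteq> v \<and> u \<in> verts G \<and> v \<in> verts G \<and> {u, v} \<in> edges G"
  by (auto simp: is_subgraph_def simple_graph_def single_edge_def card_2_iff doubleton_eq_iff)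

lemma is_subgraph_claw:
  "is_subgraph (claw z L) G \<longleftrightarrow>
     finite L \<and> z \<notin> L \<and> insert z L \<subseteq> verts G \<and> (\<lambda>l. {z, l}) ` L \<subseteq> edges G"
  by (auto simp: is_subgraph_def simple_graph_def claw_def card_2_iff doubleton_eq_iff)

lemma isomorphic_single_edge: "u \<noteq> v \<Longrightarrow> isomorphic (single_edge (u, v)) K2"
  unfolding isomorphic_def
  by (rule exI[of _ "\<lambda>x. if x = u then 0 else 1"])
     (auto simp: single_edge_def K2_def bij_betw_def inj_on_def)

lemma isomorphic_claw:
  assumes "distinct [z, a, b, c]"
  shows "isomorphic (claw z {a, b, c}) K13"
  unfolding isomorphic_def
  using assms
  \<comment> \<open>The center goes to \<open>0\<close>, the vertex of \<open>K13\<close> common to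
    its three edges; within the claw the last branch is reached only by \<open>c\<close>.\<close>
  by (intro exI[of _ "\<lambda>x. if x = z then 0 else if x = a then 1 else if x = b then 2 else 3"])
     (auto simp: claw_def K13_def bij_betw_def inj_on_def insert_commute)

lemma verts_single_edge: "verts (single_edge (u, v)) = {u, v}"
  by (simp add: single_edge_def)

lemma verts_claw: "verts (claw z L) = insert z L"
  by (simp add: claw_def)

lemma perfect_pseudo_matching_M1: "perfect_pseudo_matching S1 M1"
  unfolding perfect_pseudo_matching_def
proof (intro conjI)
  show "\<forall>H\<in>M1. is_subgraph H S1 \<and> (isomorphic H K2 \<or> isomorphic H K13)"
    unfolding M1_def
    \<comment> \<open>\<open>S1_def\<close> waits for the second call, since unfolding it earlier
      would keep \<open>edges_S1\<close> from applying.\<close>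
    by (simp add: is_subgraph_single_edge is_subgraph_claw isomorphic_single_edge isomorphic_claw
        edges_S1 edge_set_def doubleton_eq_iff, simp add: S1_def)
  show "\<forall>H\<in>M1. \<forall>H'\<in>M1. H \<noteq> H' \<longrightarrow> verts H \<inter> verts H' = {}"
    unfolding M1_def by (simp add: verts_single_edge verts_claw)
  show "(\<Union>H\<in>M1. verts H) = verts S1"
    unfolding M1_def S1_def upto_26 by (simp add: verts_single_edge verts_claw) blast
qed

lemma perfect_pseudo_matching_M2: "perfect_pseudo_matching S2 M2"
  unfolding perfect_pseudo_matching_def
proof (intro conjI)
  show "\<forall>H\<in>M2. is_subgraph H S2 \<and> (isomorphic H K2 \<or> isomorphic H K13)"
    unfolding M2_def
    by (simp add: is_subgraph_single_edge is_subgraph_claw isomorphic_single_edge isomorphic_claw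
        edges_S2 edge_set_def doubleton_eq_iff, simp add: S2_def)
  show "\<forall>H\<in>M2. \<forall>H'\<in>M2. H \<noteq> H' \<longrightarrow> verts H \<inter> verts H' = {}"
    unfolding M2_def by (simp add: verts_single_edge verts_claw)
  show "(\<Union>H\<in>M2. verts H) = verts S2"
    unfolding M2_def S2_def upto_26 by (simp add: verts_single_edge verts_claw) blast
qed

section \<open>Explicit drawings of the two contractions\<close>

text \<open>One point for each of the ten members; the last branch is the claw with center
  \<open>13\<close>.\<close>

definition place1 :: "nat \<Rightarrow> point" where
  "place1 v =
     (if v \<in> {1,2} then (7, 7) else if v \<in> {5,6} then (6, 8) else
      if v \<in> {7,8} then (7, 3) else if v \<in> {21,23} then (2, 9) else
      if v \<in> {22,24} then (4, 0) else if v \<in> {19,25} then (1, 5) else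
      if v \<in> {20,26} then (1, 2) else if v \<in> {14,9,10,18} then (3, 7) else
      if v \<in> {16,11,12,17} then (4, 3) else (4, 4))"

text \<open>The contraction has five pairs of parallel edges. For instance, \<open>(1, 4)\<close>
  and \<open>(2, 3)\<close> both join \<open>(7, 7)\<close> to \<open>(4, 4)\<close>, with bends on
  opposite sides of the diagonal.\<close>

definition drawing1 :: "(nat \<times> nat \<times> point) list" where
  "drawing1 =
    [(1, 4, (6, 5)), (2, 3, (5, 6)), (5, 10, (4, 7)), (6, 9, (4, 9)), (8, 11, (5, 4)),
     (7, 12, (5, 2)), (3, 10, (4, 6)), (4, 11, (3, 3)), (5, 21, (4, 10)), (9, 23, (3, 8)),
     (8, 22, (5, 0)), (12, 24, (3, 1)), (1, 6, (7, 8)), (2, 7, (8, 5)), (23, 25, (0, 9)),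
     (25, 26, (0, 4)), (24, 26, (2, 1)), (18, 21, (1, 8)), (18, 19, (1, 6)), (17, 20, (2, 2)),
     (17, 22, (5, 1)), (15, 20, (3, 4)), (15, 19, (2, 5))]"

text \<open>One point for each of the nine members; the last branch is the claw with center
  \<open>17\<close>.\<close>

definition place2 :: "nat \<Rightarrow> point" where
  "place2 v =
     (if v \<in> {1,8} then (9, 6) else if v \<in> {2,5} then (2, 1) else
      if v \<in> {13,14} then (5, 5) else if v \<in> {21,22} then (5, 10) else
      if v \<in> {23,24} then (1, 7) else if v \<in> {4,3,6,7} then (7, 1) else
      if v \<in> {10,9,11,12} then (6, 4) else if v \<in> {18,16,25,26} then (3, 5) else (5, 6))"

definition drawing2 :: "(nat \<times> nat \<times> point) list" where
  "drawing2 =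
    [(1, 3, (8, 4)), (2, 3, (5, 0)), (6, 8, (8, 3)), (1, 20, (7, 7)), (8, 21, (8, 8)),
     (5, 7, (5, 2)), (2, 26, (2, 3)), (5, 23, (0, 4)), (22, 24, (3, 8)), (19, 21, (6, 8)),
     (19, 25, (3, 7)), (23, 25, (2, 7)), (20, 22, (7, 8)), (24, 26, (1, 6)), (6, 9, (6, 2)),
     (7, 11, (7, 2)), (9, 13, (4, 3)), (11, 14, (5, 4)), (12, 15, (7, 6)), (12, 16, (4, 2)),
     (14, 15, (6, 5)), (13, 16, (4, 6))]"

text \<open>A finite computation with integers: 23 bends and 253 pairs of arcs.\<close>

lemma uncrossed_drawing1: "uncrossed (map (\<lambda>(i, j, m). (place1 i, m, place1 j)) drawing1)"
  by code_simp

lemma uncrossed_drawing2: "uncrossed (map (\<lambda>(i, j, m). (place2 i, m, place2 j)) drawing2)"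
  by code_simp

lemma planarizing_M1: "planarizing S1 M1"
proof (rule planarizing_if_drawing[OF perfect_pseudo_matching_M1,
      where q = place1 and D = drawing1])
  show "finite M1"
    by (simp add: M1_def)
  have "\<forall>H\<in>M1. \<forall>i\<in>verts H. \<forall>v\<in>verts S1. place1 v = place1 i \<longleftrightarrow> v \<in> verts H"
    unfolding M1_def S1_def upto_26 by (simp add: verts_single_edge verts_claw place1_def)
  then show "place1 v = place1 i \<longleftrightarrow> v \<in> verts H"
    if "H \<in> M1" "i \<in> verts H" "v \<in> verts S1" for H i v
    using that by blast
  show "edges S1 - matching_edges M1 = (\<lambda>(i, j, m). {i, j}) ` set drawing1"
    unfolding edges_S1 M1_def matching_edges_def drawing1_def edge_set_def
    \<comment> \<open>The difference of two explicit sets is computed element by element, with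
      \<open>doubleton_eq_iff\<close> deciding equality of edges.\<close>
    by (simp add: single_edge_def claw_def doubleton_eq_iff insert_Diff_if)
  have "\<forall>(i, j, m) \<in> set drawing1. i \<in> verts S1 \<and> j \<in> verts S1"
    by (simp add: drawing1_def S1_def)
  then show "i \<in> verts S1 \<and> j \<in> verts S1" if "(i, j, m) \<in> set drawing1" for i j m
    using that by blast
  have "\<forall>H\<in>M1. \<exists>(i, j, m) \<in> set drawing1. i \<in> verts H \<or> j \<in> verts H"
    by (simp add: drawing1_def M1_def verts_single_edge verts_claw)
  then show "\<exists>(i, j, m) \<in> set drawing1. i \<in> verts H \<or> j \<in> verts H" if "H \<in> M1" for H
    using that by blast
qed (rule uncrossed_drawing1)

lemma planarizing_M2: "planarizing S2 M2"
proof (rule planarizing_if_drawing[OF perfect_pseudo_matching_M2,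
      where q = place2 and D = drawing2])
  show "finite M2"
    by (simp add: M2_def)
  \<comment> \<open>Bounded quantifiers over explicit sets unfold into finitely many numeral
    equations.\<close>
  have "\<forall>H\<in>M2. \<forall>i\<in>verts H. \<forall>v\<in>verts S2. place2 v = place2 i \<longleftrightarrow> v \<in> verts H"
    unfolding M2_def S2_def upto_26 by (simp add: verts_single_edge verts_claw place2_def)
  then show "place2 v = place2 i \<longleftrightarrow> v \<in> verts H"
    if "H \<in> M2" "i \<in> verts H" "v \<in> verts S2" for H i v
    using that by blast
  show "edges S2 - matching_edges M2 = (\<lambda>(i, j, m). {i, j}) ` set drawing2"
    unfolding edges_S2 M2_def matching_edges_def drawing2_def edge_set_def
    by (simp add: single_edge_def claw_def doubleton_eq_iff insert_Diff_if)
  have "\<forall>(i, j, m) \<in> set drawing2. i \<in> verts S2 \<and> j \<in> verts S2"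
    by (simp add: drawing2_def S2_def)
  then show "i \<in> verts S2 \<and> j \<in> verts S2" if "(i, j, m) \<in> set drawing2" for i j m
    using that by blast
  have "\<forall>H\<in>M2. \<exists>(i, j, m) \<in> set drawing2. i \<in> verts H \<or> j \<in> verts H"
    by (simp add: drawing2_def M2_def verts_single_edge verts_claw)
  then show "\<exists>(i, j, m) \<in> set drawing2. i \<in> verts H \<or> j \<in> verts H" if "H \<in> M2" for H
    using that by blast
qed (rule uncrossed_drawing2)

theorem mainTheorem5:
  shows "(\<exists>M. perfect_pseudo_matching S1 M \<and> planarizing S1 M) \<and>
         (\<exists>M. perfect_pseudo_matching S2 M \<and> planarizing S2 M) \<and>
         perfect_pseudo_matching S1 M1 \<and> planarizing S1 M1 \<and>
         perfect_pseudo_matching S2 M2 \<and> planarizing S2 M2"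
  using perfect_pseudo_matching_M1 planarizing_M1 perfect_pseudo_matching_M2 planarizing_M2
  by blast

end
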